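(* Let $f:\mathbb{R}\to\mathbb{R}$ be a smooth convex function with a unique extreme point (minimizer) $t^*$, and let $p>0$. Suppose $f$ satisfies $p$-order Lipschitz continuous gradient: there is $\mu>0$ with $|f^{(1)}(x)-f^{(1)}(y)|\le\mu|x-y|^p$ for all $x,y\in\mathbb{R}$. Let $0<\alpha<2$ with $p<\alpha<1+p$. Then, for arbitrary $\rho>0$, the fractional order gradient method $$t_{k+2}=t_{k+1}-\rho f^{(1)}(t_{k+1})\,|t_{k+1}-t_k|^{1-\alpha},\qquad k\ge1,$$ always converges to a bounded region of $t^*$, and moreover the upper bound of this region is $(\rho\mu)^{\frac{1}{\alpha-p}}$: every sequence $(t_k)_{k\ge1}$ generated by the method satisfies $\limsup_{k\to\infty}|t_k-t^*|\le(\rho\mu)^{\frac{1}{\alpha-p}}$.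
   Context: $f^{(1)}$ denotes the first derivative of $f$. A sequence generated by the method is an infinite real sequence $(t_k)_{k\ge 1}$, started from real initial points $t_1\neq t_2$, satisfying the recursion for all $k\ge1$. When $\alpha>1$ the exponent $1-\alpha$ is negative and the recursion only makes sense while $t_{k+1}\ne t_k$; in that case it is assumed that $t_{k+1}\neq t_k$ for all $k$. The standing range of the gradient order for the method is $0<\alpha<2$. *)

theory Defs
  imports "HOL-Analysis.Analysis"
begin

(* In the library 0 powr 0 = 0; here the usual convention 0 ^ 0 = 1 is restored, so that the
   order \<alpha> = 1 gives ordinary gradient descent. *)
definition rpow :: "real \<Rightarrow> real \<Rightarrow> real" where
  "rpow x a = (if a = 0 then 1 else x powr a)"

(* Sequences are indexed from 1; the value t 0 is irrelevant. For \<alpha> > 1 the exponent is negative,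
   and the last conjunct keeps the method from evaluating it at base 0. *)
definition frac_grad_seq :: "(real \<Rightarrow> real) \<Rightarrow> real \<Rightarrow> real \<Rightarrow> (nat \<Rightarrow> real) \<Rightarrow> bool" where
  "frac_grad_seq f \<alpha> \<rho> t \<longleftrightarrow>
     t 1 \<noteq> t 2 \<and>
     (\<forall>k\<ge>1. t (k + 2) =
        t (k + 1) - \<rho> * deriv f (t (k + 1)) * rpow \<bar>t (k + 1) - t k\<bar> (1 - \<alpha>)) \<and>
     (\<alpha> > 1 \<longrightarrow> (\<forall>k\<ge>1. t (k + 1) \<noteq> t k))"

definition unique_minimizer :: "(real \<Rightarrow> real) \<Rightarrow> real \<Rightarrow> bool" where
  "unique_minimizer f s \<longleftrightarrow> (\<forall>x. (\<forall>y. f x \<le> f y) \<longleftrightarrow> x = s)"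

definition lipschitz_gradient :: "real \<Rightarrow> real \<Rightarrow> (real \<Rightarrow> real) \<Rightarrow> bool" where
  "lipschitz_gradient p \<mu> f \<longleftrightarrow>
     (\<forall>x y. \<bar>deriv f x - deriv f y\<bar> \<le> \<mu> * \<bar>x - y\<bar> powr p)"

end

theory Submission
  imports Defs
begin

text \<open>Put the minimizer at 0, let \<open>s n\<close> be the length of the step arriving at \<open>x n\<close>, and take logarithms
  that put the radius \<open>R = (\<rho> \<mu>) powr (1 / (\<alpha> - p))\<close> at the origin: \<open>v = ln (s / R)\<close> and
  \<open>\<gamma> = ln (\<rho> \<bar>g x\<bar> / R powr \<alpha>)\<close>. The method becomes the affine recursion \<open>v' = \<gamma> + (1 - \<alpha>) v\<close>. A step
  that keeps its side of the minimizer moves closer to it, so \<open>\<gamma>\<close> does not increase; a step that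
  crosses the minimizer lands within its own length, so the Lipschitz condition gives \<open>\<gamma>' \<le> p v'\<close>.

  With infinitely many crossings, an upper level \<open>U \<ge> 0\<close> for this system is kept by every step and
  shrinks by a constant factor at every crossing. Hence \<open>limsup v \<le> 0\<close>, and the distances to the
  minimizer, which can only grow at a crossing, are eventually below any bound beyond \<open>R\<close>. With
  finitely many crossings the distances decrease and the step lengths tend to 0, which is
  incompatible with a gradient bounded away from 0.\<close>

section \<open>Convex functions on the line\<close>

lemma convex_on_above_tangent_deriv:
  fixes f :: "real \<Rightarrow> real"
  assumes "convex_on UNIV f" and "f differentiable at c"
  shows "deriv f c * (y - c) \<le> f y - f c"
  using assms convex_on_imp_above_tangent[of UNIV f c y "deriv f c"]
  by (simp add: DERIV_deriv_iff_real_differentiable)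

lemma convex_on_imp_mono_deriv:
  fixes f :: "real \<Rightarrow> real"
  assumes convex: "convex_on UNIV f" and diff: "\<And>z. f differentiable at z"
  shows "mono (deriv f)"
proof
  fix a b :: real assume "a \<le> b"
  have "deriv f a * (b - a) \<le> deriv f b * (b - a)"
    using convex_on_above_tangent_deriv[OF convex diff, of a b]
      convex_on_above_tangent_deriv[OF convex diff, of b a]
    by (simp add: algebra_simps)
  thus "deriv f a \<le> deriv f b"
    using \<open>a \<le> b\<close> by (cases "a = b") auto
qed

lemma convex_on_deriv_eq_0_iff:
  fixes f :: "real \<Rightarrow> real"
  assumes convex: "convex_on UNIV f" and diff: "f differentiable at c"
  shows "deriv f c = 0 \<longleftrightarrow> (\<forall>y. f c \<le> f y)"
proof
  assume "deriv f c = 0"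
  thus "\<forall>y. f c \<le> f y"
    using convex_on_above_tangent_deriv[OF convex diff] by simp
next
  assume "\<forall>y. f c \<le> f y"
  thus "deriv f c = 0"
    using diff DERIV_local_min[of f "deriv f c" c 1]
    by (simp add: DERIV_deriv_iff_real_differentiable)
qed

section \<open>Recurrences with resets\<close>

lemma powr_recurrence_not_tendsto_0:
  fixes e :: "nat \<Rightarrow> real"
  assumes "0 < \<alpha>" and "0 < \<kappa>" and pos: "\<And>n. 0 < e n"
    and growth: "\<forall>\<^sub>F n in sequentially. \<kappa> * e n powr (1 - \<alpha>) \<le> e (Suc n)"
  shows "\<not> e \<longlonglongrightarrow> 0"
proof
  assume lim: "e \<longlonglongrightarrow> 0"
  have "(\<lambda>n. e n powr \<alpha>) \<longlonglongrightarrow> 0 powr \<alpha>"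
    using \<open>0 < \<alpha>\<close> pos by (intro tendsto_powr' lim tendsto_const) (auto simp: less_imp_le)
  hence "\<forall>\<^sub>F n in sequentially. e n powr \<alpha> < \<kappa>"
    using \<open>0 < \<kappa>\<close> by (intro order_tendstoD(2)[of _ 0]) auto
  with growth have "\<forall>\<^sub>F n in sequentially. e n \<le> e (Suc n)"
  proof eventually_elim
    case (elim n)
    have "e n = e n powr \<alpha> * e n powr (1 - \<alpha>)"
      using pos[of n] by (simp add: powr_add[symmetric])
    also have "\<dots> \<le> \<kappa> * e n powr (1 - \<alpha>)"
      using elim by (intro mult_right_mono) auto
    also have "\<dots> \<le> e (Suc n)" using elim by simp
    finally show ?case .
  qed
  then obtain K where "\<And>n. K \<le> n \<Longrightarrow> e n \<le> e (Suc n)"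
    by (auto simp: eventually_sequentially)
  hence "incseq (\<lambda>n. e (n + K))" by (intro incseq_SucI) simp
  hence "e (0 + K) \<le> 0"
    by (rule incseq_le) (rule LIMSEQ_ignore_initial_segment[OF lim])
  with pos[of K] show False by simp
qed

locale resetting_recurrence =
  fixes v \<gamma> :: "nat \<Rightarrow> real" and reset :: "nat \<Rightarrow> bool" and p \<alpha> :: real
  assumes p_pos: "0 < p" and p_less: "p < \<alpha>" and \<alpha>_less: "\<alpha> < 2" and \<alpha>_less_p: "\<alpha> < 1 + p"
    and v_Suc: "\<And>n. v (Suc n) = \<gamma> (Suc n) + (1 - \<alpha>) * v n"
    and \<gamma>_reset: "\<And>n. reset n \<Longrightarrow> \<gamma> (Suc n) \<le> p * v n"
    and \<gamma>_antimono: "\<And>n. \<not> reset n \<Longrightarrow> \<gamma> (Suc n) \<le> \<gamma> n"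
begin

text \<open>The second condition matters for \<open>\<alpha> \<le> 1\<close>, the third for \<open>\<alpha> > 1\<close>; in each range the other one is
  implied.\<close>
definition below :: "real \<Rightarrow> nat \<Rightarrow> bool" where
  "below U n \<longleftrightarrow> v n \<le> U \<and> \<gamma> n \<le> \<alpha> * U \<and> \<gamma> n + (1 - \<alpha>) * v n \<le> U"

lemma belowI:
  assumes "v n \<le> U"
    and low: "\<alpha> \<le> 1 \<Longrightarrow> \<gamma> n \<le> \<alpha> * U"
    and high: "1 < \<alpha> \<Longrightarrow> \<gamma> n + (1 - \<alpha>) * v n \<le> U"
  shows "below U n"
proof (cases "\<alpha> \<le> 1")
  case True
  hence "(1 - \<alpha>) * v n \<le> (1 - \<alpha>) * U"
    using \<open>v n \<le> U\<close> by (intro mult_left_mono) auto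
  with low[OF True] \<open>v n \<le> U\<close> show ?thesis by (simp add: below_def algebra_simps)
next
  case False
  hence "(\<alpha> - 1) * v n \<le> (\<alpha> - 1) * U"
    using \<open>v n \<le> U\<close> by (intro mult_left_mono) auto
  with high False \<open>v n \<le> U\<close> show ?thesis by (simp add: below_def algebra_simps)
qed

lemma exists_below: "\<exists>U\<ge>0. below U n"
proof (intro exI conjI)
  define U where "U = Max {0, v n, \<gamma> n / \<alpha>, \<gamma> n + (1 - \<alpha>) * v n}"
  show "0 \<le> U" by (simp add: U_def)
  have "\<gamma> n / \<alpha> \<le> U" "v n \<le> U" "\<gamma> n + (1 - \<alpha>) * v n \<le> U" by (simp_all add: U_def)
  thus "below U n"
    using p_pos p_less by (simp add: below_def pos_divide_le_eq mult.commute)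
qed

definition rate :: real where
  "rate = 1 - (\<alpha> - p) * min 1 (2 - \<alpha>)"

lemma rate_nonneg: "0 \<le> rate" and rate_less_1: "rate < 1"
proof -
  have "(\<alpha> - p) * min 1 (2 - \<alpha>) \<le> 1 * 1"
    using p_less \<alpha>_less \<alpha>_less_p by (intro mult_mono) auto
  thus "0 \<le> rate" by (simp add: rate_def)
  show "rate < 1" using p_less \<alpha>_less by (simp add: rate_def)
qed

lemma reset_coefficient_le_rate: "1 - (\<alpha> - p) \<le> rate"
proof -
  have "(\<alpha> - p) * min 1 (2 - \<alpha>) \<le> (\<alpha> - p) * 1"
    using p_less by (intro mult_left_mono) auto
  thus ?thesis by (simp add: rate_def)
qed

lemma reset_bounds:
  assumes "reset n" and "v n \<le> U"
  shows "v (Suc n) \<le> (1 - (\<alpha> - p)) * U" and "\<gamma> (Suc n) \<le> p * U"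
proof -
  have "v (Suc n) \<le> (1 - (\<alpha> - p)) * v n"
    using \<gamma>_reset[OF \<open>reset n\<close>] by (simp add: v_Suc algebra_simps)
  also have "\<dots> \<le> (1 - (\<alpha> - p)) * U"
    using \<open>v n \<le> U\<close> \<alpha>_less_p by (intro mult_left_mono) auto
  finally show "v (Suc n) \<le> (1 - (\<alpha> - p)) * U" .
  have "\<gamma> (Suc n) \<le> p * v n" by (rule \<gamma>_reset[OF \<open>reset n\<close>])
  also have "\<dots> \<le> p * U" using \<open>v n \<le> U\<close> p_pos by simp
  finally show "\<gamma> (Suc n) \<le> p * U" .
qed

text \<open>For \<open>\<alpha> > 1\<close> the right-hand side is a weighted mean.\<close>
lemma \<gamma>_Suc_plus_v_Suc:
  "\<gamma> (Suc n) + (1 - \<alpha>) * v (Suc n) = (2 - \<alpha>) * v (Suc n) + (\<alpha> - 1) * v n"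
  by (simp add: v_Suc algebra_simps)

lemma below_Suc_if_reset:
  assumes "0 \<le> U" and "below U n" and "reset n"
  shows "below (rate * U) (Suc n)"
proof (rule belowI)
  have v: "v n \<le> U" using \<open>below U n\<close> by (simp add: below_def)
  note bounds = reset_bounds[OF \<open>reset n\<close> v]
  have "(1 - (\<alpha> - p)) * U \<le> rate * U"
    using reset_coefficient_le_rate \<open>0 \<le> U\<close> by (intro mult_right_mono) auto
  with bounds(1) show "v (Suc n) \<le> rate * U" by simp
  show "\<gamma> (Suc n) \<le> \<alpha> * (rate * U)" if "\<alpha> \<le> 1"
  proof -
    have "\<alpha> * rate - p = (1 - \<alpha>) * (\<alpha> - p)"
      using that by (simp add: rate_def algebra_simps)
    moreover have "0 \<le> (1 - \<alpha>) * (\<alpha> - p)" using that p_less by simp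
    ultimately have "p \<le> \<alpha> * rate" by linarith
    hence "p * U \<le> \<alpha> * rate * U"
      using \<open>0 \<le> U\<close> by (rule mult_right_mono)
    with bounds(2) show ?thesis by (simp add: mult.assoc)
  qed
  show "\<gamma> (Suc n) + (1 - \<alpha>) * v (Suc n) \<le> rate * U" if "1 < \<alpha>"
  proof -
    have "\<gamma> (Suc n) + (1 - \<alpha>) * v (Suc n) = (2 - \<alpha>) * v (Suc n) + (\<alpha> - 1) * v n"
      by (rule \<gamma>_Suc_plus_v_Suc)
    also have "\<dots> \<le> (2 - \<alpha>) * ((1 - (\<alpha> - p)) * U) + (\<alpha> - 1) * U"
      using bounds(1) v that \<alpha>_less by (intro add_mono mult_left_mono) auto
    also have "\<dots> = rate * U"
      using that by (simp add: rate_def algebra_simps)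
    finally show ?thesis .
  qed
qed

lemma below_Suc_if_not_reset:
  assumes "below U n" and "\<not> reset n"
  shows "below U (Suc n)"
proof (rule belowI)
  have v: "v n \<le> U" using \<open>below U n\<close> by (simp add: below_def)
  show v': "v (Suc n) \<le> U" and "\<gamma> (Suc n) \<le> \<alpha> * U"
    using \<gamma>_antimono[OF \<open>\<not> reset n\<close>] \<open>below U n\<close> by (simp_all add: below_def v_Suc)
  show "\<gamma> (Suc n) + (1 - \<alpha>) * v (Suc n) \<le> U" if "1 < \<alpha>"
    unfolding \<gamma>_Suc_plus_v_Suc using v v' that \<alpha>_less by (intro convex_bound_le) auto
qed

lemma below_mono_level:
  assumes "below U n" and "U \<le> V"
  shows "below V n"
proof -
  have "\<alpha> * U \<le> \<alpha> * V"
    using \<open>U \<le> V\<close> p_pos p_less by (intro mult_left_mono) auto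
  with assms show ?thesis by (simp add: below_def)
qed

lemma below_Suc:
  assumes "0 \<le> U" and "below U n"
  shows "below U (Suc n)"
proof (cases "reset n")
  case True
  have "rate * U \<le> U"
    using rate_less_1 \<open>0 \<le> U\<close> by (intro mult_left_le_one_le rate_nonneg) auto
  with below_Suc_if_reset[OF assms True] show ?thesis by (rule below_mono_level)
next
  case False
  with \<open>below U n\<close> show ?thesis by (rule below_Suc_if_not_reset)
qed

lemma below_mono_index: "m \<le> n \<Longrightarrow> 0 \<le> U \<Longrightarrow> below U m \<Longrightarrow> below U n"
  by (induction n rule: dec_induct) (auto intro: below_Suc)

lemma exists_below_rate_power:
  assumes freq: "\<exists>\<^sub>F n in sequentially. reset n" and "0 \<le> U" and "below U m"
  shows "\<exists>n. below (rate ^ k * U) n"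
proof (induction k)
  case 0
  show ?case using \<open>below U m\<close> by auto
next
  case (Suc k)
  have nonneg: "0 \<le> rate ^ k * U" using rate_nonneg \<open>0 \<le> U\<close> by simp
  obtain n where below: "below (rate ^ k * U) n" using Suc.IH by blast
  obtain n' where "n \<le> n'" "reset n'"
    using freq by (auto simp: frequently_sequentially)
  hence "below (rate * (rate ^ k * U)) (Suc n')"
    using below_mono_index[OF _ nonneg below] by (intro below_Suc_if_reset[OF nonneg])
  thus ?case by (auto simp: mult.assoc)
qed

lemma eventually_v_less:
  assumes freq: "\<exists>\<^sub>F n in sequentially. reset n" and "0 < \<epsilon>"
  shows "\<forall>\<^sub>F n in sequentially. v n < \<epsilon>"
proof -
  obtain U where "0 \<le> U" and start: "below U 0" using exists_below by blast
  have "(\<lambda>k. rate ^ k * U) \<longlonglongrightarrow> 0"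
    using rate_nonneg rate_less_1 by (intro tendsto_mult_left_zero LIMSEQ_realpow_zero)
  hence "\<forall>\<^sub>F k in sequentially. rate ^ k * U < \<epsilon>"
    using \<open>0 < \<epsilon>\<close> by (rule order_tendstoD)
  then obtain k where level: "rate ^ k * U < \<epsilon>"
    by (auto dest: eventually_happens)
  obtain m where below: "below (rate ^ k * U) m"
    using exists_below_rate_power[OF freq \<open>0 \<le> U\<close> start] by blast
  have "v n < \<epsilon>" if "m \<le> n" for n
  proof -
    have "below (rate ^ k * U) n"
      using that _ below by (rule below_mono_index) (use rate_nonneg \<open>0 \<le> U\<close> in simp)
    with level show ?thesis by (simp add: below_def)
  qed
  thus ?thesis by (rule eventually_sequentiallyI)
qed

end

section \<open>Fractional descent for a monotone gradient\<close>

locale mono_with_zero_at_0 =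
  fixes g :: "real \<Rightarrow> real"
  assumes g_mono: "mono g"
    and g_zero_iff: "\<And>z. g z = 0 \<longleftrightarrow> z = 0"
begin

lemma g_sgn: "sgn (g z) = sgn z"
  using monoD[OF g_mono, of 0 z] monoD[OF g_mono, of z 0] g_zero_iff[of z] g_zero_iff[of 0]
  by (cases z "0 :: real" rule: linorder_cases) (auto simp: sgn_if)

lemma abs_g_mono:
  assumes "sgn y = sgn z" and "\<bar>y\<bar> \<le> \<bar>z\<bar>"
  shows "\<bar>g y\<bar> \<le> \<bar>g z\<bar>"
proof -
  consider "0 < y" "0 < z" | "y < 0" "z < 0" | "y = 0"
    using assms(1) by (cases y "0 :: real" rule: linorder_cases) (auto simp: sgn_if split: if_splits)
  thus ?thesis
  proof cases
    case 1
    hence "0 \<le> g y" "g y \<le> g z"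
      using assms(2) monoD[OF g_mono, of 0 y] monoD[OF g_mono, of y z] g_zero_iff[of 0] by simp_all
    thus ?thesis by simp
  next
    case 2
    hence "g y \<le> 0" "g z \<le> g y"
      using assms(2) monoD[OF g_mono, of y 0] monoD[OF g_mono, of z y] g_zero_iff[of 0] by simp_all
    thus ?thesis by simp
  next
    case 3
    thus ?thesis using g_zero_iff[of 0] by simp
  qed
qed

lemma abs_g_bounded_below:
  assumes "0 < L"
  obtains m where "0 < m" and "\<And>z. L \<le> \<bar>z\<bar> \<Longrightarrow> m \<le> \<bar>g z\<bar>"
proof
  show "0 < min (g L) (- g (- L))"
    using assms g_sgn[of L] g_sgn[of "- L"] by (auto simp: sgn_if split: if_splits)
  show "min (g L) (- g (- L)) \<le> \<bar>g z\<bar>" if "L \<le> \<bar>z\<bar>" for z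
    using that monoD[OF g_mono, of L z] monoD[OF g_mono, of z "- L"]
    by (auto simp: abs_if split: if_splits)
qed

end

text \<open>\<open>s n\<close> is the length of the step that arrives at \<open>x n\<close>; \<open>s 0\<close> comes from the point before \<open>x 0\<close>.\<close>
locale fractional_descent = mono_with_zero_at_0 g for g :: "real \<Rightarrow> real" +
  fixes x s :: "nat \<Rightarrow> real" and p \<mu> \<alpha> \<rho> :: real
  assumes g_bound: "\<And>z. \<bar>g z\<bar> \<le> \<mu> * \<bar>z\<bar> powr p"
    and p_pos: "0 < p" and \<mu>_pos: "0 < \<mu>" and \<rho>_pos: "0 < \<rho>"
    and \<alpha>_less: "\<alpha> < 2" and p_less: "p < \<alpha>" and \<alpha>_less_p: "\<alpha> < 1 + p"
    and x_Suc: "\<And>n. x (Suc n) = x n - \<rho> * g (x n) * rpow (s n) (1 - \<alpha>)"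
    and s_Suc: "\<And>n. s (Suc n) = \<bar>x (Suc n) - x n\<bar>"
    and s_0_pos: "0 < s 0"
begin

definition radius :: real where "radius = (\<rho> * \<mu>) powr (1 / (\<alpha> - p))"

lemma radius_pos: "0 < radius"
  using \<rho>_pos \<mu>_pos by (simp add: radius_def)

lemma s_nonneg: "0 \<le> s n"
  using s_0_pos by (cases n) (simp_all add: s_Suc)

lemma x_eq_0_if_s_eq_0: "s n = 0 \<Longrightarrow> x n = 0"
proof (induction n)
  case 0
  thus ?case using s_0_pos by simp
next
  case (Suc n)
  hence same: "x (Suc n) = x n" by (simp add: s_Suc)
  hence "g (x n) = 0 \<or> rpow (s n) (1 - \<alpha>) = 0"
    using x_Suc[of n] \<rho>_pos by simp
  hence "x n = 0 \<or> s n = 0"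
    by (auto simp: g_zero_iff rpow_def split: if_splits)
  with Suc.IH same show ?case by auto
qed

lemma x_eq_0_after: "m \<le> n \<Longrightarrow> x m = 0 \<Longrightarrow> x n = 0"
  by (induction n rule: dec_induct) (simp_all add: x_Suc g_zero_iff)

definition crossing :: "nat \<Rightarrow> bool" where
  "crossing n \<longleftrightarrow> x n * x (Suc n) \<le> 0"

lemma abs_x_Suc_le_if_crossing: "crossing n \<Longrightarrow> \<bar>x (Suc n)\<bar> \<le> s (Suc n)"
  unfolding crossing_def s_Suc by (auto simp: mult_le_0_iff)

lemma sgn_x_Suc: "\<not> crossing n \<Longrightarrow> sgn (x (Suc n)) = sgn (x n)"
  by (auto simp: crossing_def not_le zero_less_mult_iff)

lemma abs_x_Suc:
  assumes "\<not> crossing n"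
  shows "\<bar>x (Suc n)\<bar> = \<bar>x n\<bar> - s (Suc n)"
proof -
  define w where "w = \<rho> * rpow (s n) (1 - \<alpha>)"
  have "0 \<le> w" using \<rho>_pos by (simp add: w_def rpow_def)
  have x': "x (Suc n) = x n - w * g (x n)"
    by (simp add: x_Suc[of n] w_def)
  from assms consider "0 < x n" "0 < x (Suc n)" | "x n < 0" "x (Suc n) < 0"
    by (auto simp: crossing_def not_le zero_less_mult_iff)
  thus ?thesis
  proof cases
    case 1
    hence "0 \<le> w * g (x n)"
      using g_sgn[of "x n"] \<open>0 \<le> w\<close> by (intro mult_nonneg_nonneg) (auto simp: sgn_if split: if_splits)
    with 1 show ?thesis by (simp add: s_Suc x')
  next
    case 2
    hence "w * g (x n) \<le> 0"
      using g_sgn[of "x n"] \<open>0 \<le> w\<close> by (intro mult_nonneg_nonpos) (auto simp: sgn_if split: if_splits)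
    with 2 show ?thesis by (simp add: s_Suc x')
  qed
qed

lemma abs_g_x_Suc_le: "\<not> crossing n \<Longrightarrow> \<bar>g (x (Suc n))\<bar> \<le> \<bar>g (x n)\<bar>"
  using sgn_x_Suc abs_x_Suc s_nonneg[of "Suc n"] by (intro abs_g_mono) auto

lemma eventually_abs_x_le_if_crossings:
  assumes freq: "\<exists>\<^sub>F n in sequentially. crossing n" and small: "\<forall>\<^sub>F n in sequentially. s n \<le> B"
  shows "\<forall>\<^sub>F n in sequentially. \<bar>x n\<bar> \<le> B"
proof -
  obtain N where s_le: "\<And>n. N \<le> n \<Longrightarrow> s n \<le> B"
    using small by (auto simp: eventually_sequentially)
  obtain K where "N \<le> K" "crossing K"
    using freq by (auto simp: frequently_sequentially)
  have landing: "\<bar>x (Suc n)\<bar> \<le> B" if "K \<le> n" "crossing n" for n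
    using abs_x_Suc_le_if_crossing[OF that(2)] s_le[of "Suc n"] that(1) \<open>N \<le> K\<close> by simp
  have "\<bar>x n\<bar> \<le> B" if "Suc K \<le> n" for n
    using that
  proof (induction n rule: dec_induct)
    case base
    show ?case using landing \<open>crossing K\<close> by simp
  next
    case (step n)
    thus ?case
      using landing[of n] abs_x_Suc[of n] s_nonneg[of "Suc n"] by (cases "crossing n") auto
  qed
  thus ?thesis by (rule eventually_sequentiallyI)
qed

lemma limit_if_finitely_many_crossings:
  assumes "\<forall>\<^sub>F n in sequentially. \<not> crossing n"
  obtains L where "0 \<le> L" and "(\<lambda>n. \<bar>x n\<bar>) \<longlonglongrightarrow> L" and "\<forall>\<^sub>F n in sequentially. L \<le> \<bar>x n\<bar>"
    and "s \<longlonglongrightarrow> 0"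
proof -
  obtain N where no_crossing: "\<And>n. N \<le> n \<Longrightarrow> \<not> crossing n"
    using assms by (auto simp: eventually_sequentially)
  define y where "y n = \<bar>x (n + N)\<bar>" for n
  have y_Suc: "y (Suc n) = y n - s (Suc (n + N))" for n
    using abs_x_Suc[OF no_crossing, of "n + N"] by (simp add: y_def)
  have "decseq y"
    unfolding decseq_Suc_iff y_Suc using s_nonneg by simp
  then obtain L where y_lim: "y \<longlonglongrightarrow> L" and y_ge: "\<And>n. L \<le> y n"
    using decseq_convergent[of y 0] by (auto simp: y_def)
  have lim: "(\<lambda>n. \<bar>x n\<bar>) \<longlonglongrightarrow> L"
    using y_lim unfolding y_def by (rule LIMSEQ_offset)
  have "(\<lambda>n. y n - y (Suc n)) \<longlonglongrightarrow> L - L"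
    by (intro tendsto_diff y_lim LIMSEQ_Suc)
  hence "(\<lambda>n. s (n + Suc N)) \<longlonglongrightarrow> 0" by (simp add: y_Suc)
  hence "s \<longlonglongrightarrow> 0" by (rule LIMSEQ_offset)
  moreover have "0 \<le> L" using lim by (rule LIMSEQ_le_const) auto
  moreover have "L \<le> \<bar>x n\<bar>" if "N \<le> n" for n
    using y_ge[of "n - N"] that by (simp add: y_def)
  hence "\<forall>\<^sub>F n in sequentially. L \<le> \<bar>x n\<bar>" by (rule eventually_sequentiallyI)
  ultimately show thesis using that lim by blast
qed

end

locale moving_fractional_descent = fractional_descent +
  assumes s_pos: "\<And>n. 0 < s n"
begin

lemma g_x_nonzero: "g (x n) \<noteq> 0"
  using s_pos[of "Suc n"] by (auto simp: s_Suc x_Suc)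

lemma s_Suc_eq: "s (Suc n) = \<rho> * \<bar>g (x n)\<bar> * s n powr (1 - \<alpha>)"
  using \<rho>_pos s_pos[of n] by (auto simp: s_Suc x_Suc[of n] rpow_def abs_mult)

definition log_step :: "nat \<Rightarrow> real" where
  "log_step n = ln (s n) - ln radius"

definition log_grad :: "nat \<Rightarrow> real" where
  "log_grad n = ln (\<rho> * \<bar>g (x n)\<bar>) - \<alpha> * ln radius"

lemma log_step_Suc: "log_step (Suc n) = log_grad n + (1 - \<alpha>) * log_step n"
  using \<rho>_pos g_x_nonzero[of n] s_pos[of n]
  by (simp add: log_step_def log_grad_def s_Suc_eq ln_mult algebra_simps)

lemma log_grad_Suc_le:
  assumes "\<not> crossing n"
  shows "log_grad (Suc n) \<le> log_grad n"
  using abs_g_x_Suc_le[OF assms] \<rho>_pos g_x_nonzero by (simp add: log_grad_def)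

lemma log_grad_Suc_le_if_crossing:
  assumes "crossing n"
  shows "log_grad (Suc n) \<le> p * log_step (Suc n)"
proof -
  have "\<rho> * \<bar>g (x (Suc n))\<bar> \<le> \<rho> * (\<mu> * \<bar>x (Suc n)\<bar> powr p)"
    using \<rho>_pos g_bound by (intro mult_left_mono) auto
  also have "\<dots> \<le> \<rho> * (\<mu> * s (Suc n) powr p)"
    using abs_x_Suc_le_if_crossing[OF assms] \<rho>_pos \<mu>_pos p_pos
    by (intro mult_left_mono powr_mono2) auto
  finally have "ln (\<rho> * \<bar>g (x (Suc n))\<bar>) \<le> ln (\<rho> * (\<mu> * s (Suc n) powr p))"
    using \<rho>_pos g_x_nonzero by (intro ln_mono) auto
  also have "\<dots> = ln (\<rho> * \<mu>) + p * ln (s (Suc n))"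
    using \<rho>_pos \<mu>_pos s_pos[of "Suc n"] by (simp add: ln_mult)
  also have "ln (\<rho> * \<mu>) = (\<alpha> - p) * ln radius"
    using p_less by (simp add: radius_def)
  finally show ?thesis by (simp add: log_step_def log_grad_def algebra_simps)
qed

lemma eventually_s_le:
  assumes freq: "\<exists>\<^sub>F n in sequentially. crossing n" and "radius < B"
  shows "\<forall>\<^sub>F n in sequentially. s n \<le> B"
proof -
  interpret resetting_recurrence "\<lambda>n. log_step (Suc n)" log_grad crossing p \<alpha>
    using p_pos p_less \<alpha>_less \<alpha>_less_p log_step_Suc log_grad_Suc_le log_grad_Suc_le_if_crossing
    by unfold_locales
  have "0 < ln B - ln radius" using \<open>radius < B\<close> radius_pos by simp
  hence "\<forall>\<^sub>F n in sequentially. log_step (Suc n) < ln B - ln radius"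
    by (rule eventually_v_less[OF freq])
  hence "\<forall>\<^sub>F n in sequentially. s (Suc n) \<le> B"
    by eventually_elim (use s_pos radius_pos \<open>radius < B\<close> in \<open>simp add: log_step_def\<close>)
  thus ?thesis by (simp add: eventually_sequentially_Suc[of "\<lambda>n. s n \<le> B"])
qed

lemma tendsto_0_if_finitely_many_crossings:
  assumes "\<forall>\<^sub>F n in sequentially. \<not> crossing n"
  shows "x \<longlonglongrightarrow> 0"
proof -
  obtain L where "0 \<le> L" and lim: "(\<lambda>n. \<bar>x n\<bar>) \<longlonglongrightarrow> L"
    and ge: "\<forall>\<^sub>F n in sequentially. L \<le> \<bar>x n\<bar>" and "s \<longlonglongrightarrow> 0"
    using limit_if_finitely_many_crossings[OF assms] .
  have "\<not> 0 < L"
  proof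
    assume "0 < L"
    then obtain m where "0 < m" and g_ge: "\<And>z. L \<le> \<bar>z\<bar> \<Longrightarrow> m \<le> \<bar>g z\<bar>"
      using abs_g_bounded_below by blast
    from ge have "\<forall>\<^sub>F n in sequentially. \<rho> * m * s n powr (1 - \<alpha>) \<le> s (Suc n)"
      unfolding s_Suc_eq
      by eventually_elim (use g_ge \<rho>_pos in \<open>auto intro!: mult_right_mono\<close>)
    hence "\<not> s \<longlonglongrightarrow> 0"
      using p_pos p_less \<rho>_pos \<open>0 < m\<close> s_pos
      by (intro powr_recurrence_not_tendsto_0[of \<alpha> "\<rho> * m"]) auto
    with \<open>s \<longlonglongrightarrow> 0\<close> show False by contradiction
  qed
  with \<open>0 \<le> L\<close> lim show ?thesis by (simp add: tendsto_rabs_zero_iff)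
qed

lemma eventually_abs_x_le_if_moving:
  assumes "radius < B"
  shows "\<forall>\<^sub>F n in sequentially. \<bar>x n\<bar> \<le> B"
proof (cases "\<exists>\<^sub>F n in sequentially. crossing n")
  case True
  thus ?thesis using eventually_s_le[OF True assms] by (rule eventually_abs_x_le_if_crossings)
next
  case False
  hence "x \<longlonglongrightarrow> 0"
    by (intro tendsto_0_if_finitely_many_crossings) (simp add: not_frequently)
  hence "\<forall>\<^sub>F n in sequentially. \<bar>x n\<bar> < B"
    using radius_pos assms by (intro order_tendstoD(2)[of _ 0] tendsto_rabs_zero) auto
  thus ?thesis by eventually_elim simp
qed

end

context fractional_descent
begin

lemma eventually_abs_x_le:
  assumes "radius < B"
  shows "\<forall>\<^sub>F n in sequentially. \<bar>x n\<bar> \<le> B"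
proof (cases "\<exists>m. s m = 0")
  case True
  then obtain m where "x m = 0" using x_eq_0_if_s_eq_0 by blast
  hence "\<bar>x n\<bar> \<le> B" if "m \<le> n" for n
    using x_eq_0_after[OF that] radius_pos assms by simp
  thus ?thesis by (rule eventually_sequentiallyI)
next
  case False
  hence "0 < s n" for n using s_nonneg[of n] by (metis order_less_le)
  then interpret moving_fractional_descent by unfold_locales
  show ?thesis using assms by (rule eventually_abs_x_le_if_moving)
qed

lemma limsup_abs_x_le: "limsup (\<lambda>n. ereal \<bar>x n\<bar>) \<le> ereal radius"
proof (rule ereal_le_epsilon2)
  fix \<epsilon> :: real assume "0 < \<epsilon>"
  hence "\<forall>\<^sub>F n in sequentially. \<bar>x n\<bar> \<le> radius + \<epsilon>"
    by (intro eventually_abs_x_le) simp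
  thus "limsup (\<lambda>n. ereal \<bar>x n\<bar>) \<le> ereal radius + ereal \<epsilon>"
    by (intro Limsup_bounded) simp
qed

end

theorem theorem6:
  fixes f :: "real \<Rightarrow> real" and tstar p \<mu> \<alpha> \<rho> :: real and t :: "nat \<Rightarrow> real"
  assumes "f C1_differentiable_on UNIV"
    and "convex_on UNIV f"
    and "unique_minimizer f tstar"
    and "p > 0"
    and "\<mu> > 0"
    and "lipschitz_gradient p \<mu> f"
    and "0 < \<alpha>" and "\<alpha> < 2"
    and "p < \<alpha>" and "\<alpha> < 1 + p"
    and "\<rho> > 0"
    and "frac_grad_seq f \<alpha> \<rho> t"
  shows "limsup (\<lambda>k. ereal \<bar>t k - tstar\<bar>) \<le> ereal ((\<rho> * \<mu>) powr (1 / (\<alpha> - p)))"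
proof -
  have diff: "f differentiable at z" for z
    using \<open>f C1_differentiable_on UNIV\<close> by (simp add: C1_differentiable_on_eq)
  have deriv_mono: "mono (deriv f)"
    using \<open>convex_on UNIV f\<close> diff by (rule convex_on_imp_mono_deriv)
  have deriv_zero: "deriv f z = 0 \<longleftrightarrow> z = tstar" for z
    using convex_on_deriv_eq_0_iff[OF \<open>convex_on UNIV f\<close> diff] \<open>unique_minimizer f tstar\<close>
    by (simp add: unique_minimizer_def)
  have deriv_bound: "\<bar>deriv f (z + tstar)\<bar> \<le> \<mu> * \<bar>z\<bar> powr p" for z
    using \<open>lipschitz_gradient p \<mu> f\<close>[unfolded lipschitz_gradient_def, rule_format, of "z + tstar" tstar]
      deriv_zero[of tstar] by simp
  have start: "t 1 \<noteq> t 2"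
    and iteration: "t (Suc (k + 2)) =
      t (k + 2) - \<rho> * deriv f (t (k + 2)) * rpow \<bar>t (k + 2) - t (k + 1)\<bar> (1 - \<alpha>)" for k
    using \<open>frac_grad_seq f \<alpha> \<rho> t\<close> unfolding frac_grad_seq_def
    by (auto dest: spec[of _ "Suc k"])
  interpret fractional_descent "\<lambda>z. deriv f (z + tstar)" "\<lambda>k. t (k + 2) - tstar"
      "\<lambda>k. \<bar>t (k + 2) - t (k + 1)\<bar>" p \<mu> \<alpha> \<rho>
    using assms deriv_bound start iteration
    by unfold_locales (auto simp: deriv_zero numeral_2_eq_2 intro!: monoI monoD[OF deriv_mono])
  show ?thesis
    using limsup_abs_x_le limsup_shift_k[of "\<lambda>k. ereal \<bar>t k - tstar\<bar>" 2] by (simp add: radius_def)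
qed

end
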